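(* Let $n,k,h$ be integers with $2\leqslant k\leqslant n-1$ and $0\leqslant h\leqslant n-k$. Then the $h$-super edge-connectivity of the $(n,k)$-star graph $S_{n,k}$ is $$\lambda_s^{(h)}(S_{n,k})=\begin{cases}(n-h-1)(h+1) & \text{if } h\leqslant k-2 \text{ and } h\leqslant \frac{n}{2}-1,\\ (n-k+1)(k-1) & \text{otherwise.}\end{cases}$$
   Context: For integers $n,k$ with $1\leqslant k\leqslant n-1$, let $I_n=\{1,2,\ldots,n\}$ and let $P(n,k)=\{p_1p_2\cdots p_k : p_i\in I_n,\ p_i\neq p_j \text{ for } 1\leqslant i\neq j\leqslant k\}$ be the set of $k$-permutations on $I_n$. The $(n,k)$-star graph $S_{n,k}$ is the simple undirected graph with vertex set $P(n,k)$ in which a vertex $p=p_1p_2\cdots p_k$ is adjacent exactly to: (a) the vertices $p_ip_2\cdots p_{i-1}p_1p_{i+1}\cdots p_k$ for $2\leqslant i\leqslant k$ (swap $p_1$ with $p_i$); and (b) the vertices $\alpha p_2p_3\cdots p_k$ for $\alpha\in I_n\setminus\{p_i : 1\leqslant i\leqslant k\}$ (replace $p_1$ by $\alpha$). For a connected graph $G$ and an integer $h\geqslant 0$, an $h$-edge-cut of $G$ is a set $B$ of edges of $G$ such that $G-B$ (delete the edges in $B$, keep all vertices) is disconnected and has minimum degree at least $h$. The $h$-super edge-connectivity $\lambda_s^{(h)}(G)$ is the minimum cardinality over all $h$-edge-cuts of $G$ (when at least one exists). An asserted value of $\lambda_s^{(h)}(G)$ includes the assertion that an $h$-edge-cut exists.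 *)

theory Defs
  imports Complex_Main
begin

text \<open>
  A (simple undirected) graph is a pair of a vertex set and a set of edges, an edge being the
  two-element set of its endpoints.
\<close>

type_synonym 'a graph = "'a set \<times> 'a set set"

abbreviation verts :: "'a graph \<Rightarrow> 'a set" where
  "verts G \<equiv> fst G"

abbreviation edges :: "'a graph \<Rightarrow> 'a set set" where
  "edges G \<equiv> snd G"

definition finite_simple_graph :: "'a graph \<Rightarrow> bool" where
  "finite_simple_graph G \<longleftrightarrow> finite (verts G) \<and> (\<forall>e\<in>edges G. e \<subseteq> verts G \<and> card e = 2)"

definition connected_graph :: "'a graph \<Rightarrow> bool" where
  "connected_graph G \<longleftrightarrow> verts G \<noteq> {} \<and>
     (\<forall>u\<in>verts G. \<forall>v\<in>verts G. (u, v) \<in> {(x, y). {x, y} \<in> edges G}\<^sup>*)"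

definition degree :: "'a graph \<Rightarrow> 'a \<Rightarrow> nat" where
  "degree G v = card {e \<in> edges G. v \<in> e}"

definition min_degree :: "'a graph \<Rightarrow> nat" where
  "min_degree G = Min (degree G ` verts G)"

definition delete_edges :: "'a graph \<Rightarrow> 'a set set \<Rightarrow> 'a graph" where
  "delete_edges G B = (verts G, edges G - B)"

definition h_edge_cut :: "'a graph \<Rightarrow> nat \<Rightarrow> 'a set set \<Rightarrow> bool" where
  "h_edge_cut G h B \<longleftrightarrow> B \<subseteq> edges G \<and>
     \<not> connected_graph (delete_edges G B) \<and> h \<le> min_degree (delete_edges G B)"

text \<open>Only meaningful for finite graphs that have an \<open>h\<close>-edge-cut; otherwise the value is junk.\<close>

definition super_edge_connectivity :: "nat \<Rightarrow> 'a graph \<Rightarrow> nat" where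
  "super_edge_connectivity h G = (LEAST m. \<exists>B. h_edge_cut G h B \<and> card B = m)"

text \<open>
  A \<open>k\<close>-permutation \<open>p\<^sub>1 p\<^sub>2 \<dots> p\<^sub>k\<close> is a list, so \<open>p\<^sub>i\<close> is \<open>p ! (i - 1)\<close> and \<open>p\<^sub>1\<close> is \<open>p ! 0\<close>.
\<close>

definition k_permutations :: "nat \<Rightarrow> nat \<Rightarrow> nat list set" where
  "k_permutations n k = {p. length p = k \<and> distinct p \<and> set p \<subseteq> {1..n}}"

definition star_neighbours :: "nat \<Rightarrow> nat \<Rightarrow> nat list \<Rightarrow> nat list set" where
  "star_neighbours n k p =
     {p[0 := p ! i, i := p ! 0] | i. 1 \<le> i \<and> i < k} \<union>
     {p[0 := a] | a. a \<in> {1..n} - set p}"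

definition star_graph :: "nat \<Rightarrow> nat \<Rightarrow> nat list graph" where
  "star_graph n k =
     (k_permutations n k, {{p, q} | p q. p \<in> k_permutations n k \<and> q \<in> star_neighbours n k p})"

lemma star_neighbours_closed:
  assumes p: "p \<in> k_permutations n k" and q: "q \<in> star_neighbours n k p" and "1 \<le> k"
  shows "q \<in> k_permutations n k \<and> q \<noteq> p \<and> p \<in> star_neighbours n k q"
proof -
  have p': "length p = k" "distinct p" "set p \<subseteq> {1..n}"
    using p by (auto simp: k_permutations_def)
  from q consider (swap) i where "q = p[0 := p ! i, i := p ! 0]" "1 \<le> i" "i < k"
    | (replace) a where "q = p[0 := a]" "a \<in> {1..n} - set p"
    unfolding star_neighbours_def by blast
  then show ?thesis
  proof cases
    case swap
    have "p ! 0 \<noteq> p ! i"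
      using p' swap(2,3) by (simp add: nth_eq_iff_index_eq)
    moreover have q0: "q ! 0 = p ! i" "q ! i = p ! 0"
      using p' swap by simp_all
    moreover have "p = q[0 := q ! i, i := q ! 0]"
      unfolding q0 using p' swap by (intro nth_equalityI) (simp_all add: nth_list_update)
    moreover have "set q = set p" "distinct q" "length q = length p"
      using p' swap(2,3) unfolding swap(1) by (simp_all add: set_swap distinct_swap)
    ultimately show ?thesis
      using p' swap(2,3) unfolding k_permutations_def star_neighbours_def mem_Collect_eq Un_iff
      by metis
  next
    case replace
    have in_p: "p ! 0 \<in> set p" and nonempty: "0 < length p"
      using p'(1) \<open>1 \<le> k\<close> by simp_all
    have "q ! 0 = a" "a \<noteq> p ! 0"
      using replace in_p nonempty by (simp, blast)
    moreover have "p ! 0 \<in> {1..n}"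
      using p'(3) in_p by blast
    moreover have "p ! 0 \<notin> set q"
    proof -
      obtain x xs where "p = x # xs" using p' \<open>1 \<le> k\<close> by (cases p) auto
      then show ?thesis using p' replace by auto
    qed
    moreover have "p = q[0 := p ! 0]"
      using replace by simp
    moreover have "set q \<subseteq> {1..n}" "distinct q" "length q = k"
      using p' replace set_update_subset_insert[of p 0 a] by (auto intro: distinct_list_update)
    ultimately show ?thesis
      using p' unfolding k_permutations_def star_neighbours_def mem_Collect_eq Un_iff Diff_iff
      by metis
  qed
qed

lemma finite_simple_graph_star_graph:
  assumes "1 \<le> k"
  shows "finite_simple_graph (star_graph n k)"
proof -
  have "finite (k_permutations n k)"
    by (rule finite_subset[OF _ finite_lists_length_eq[of "{1..n}" k]])
      (auto simp: k_permutations_def)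
  moreover have "{p, q} \<subseteq> k_permutations n k \<and> card {p, q} = 2"
    if "p \<in> k_permutations n k" "q \<in> star_neighbours n k p" for p q
    using star_neighbours_closed[OF that assms] that by auto
  ultimately show ?thesis
    by (auto simp: finite_simple_graph_def star_graph_def)
qed

end

theory Submission
  imports Defs
begin

text \<open>
  Put \<open>m = n - k\<close>. Fixing the symbols outside a set \<open>F\<close> of \<open>d\<close> positions (other than position 0) leaves
  a copy of \<open>S\<^sub>m\<^sub>+\<^sub>d\<^sub>+\<^sub>1\<^sub>,\<^sub>d\<^sub>+\<^sub>1\<close>, a fiber. Let a fiber be partitioned into \<open>X\<close> and \<open>Y\<close> that both
  induce minimum degree at least \<open>h\<close>. A position \<open>q \<in> F\<close> cuts the fiber into slices, which are
  fibers with \<open>d - 1\<close>, and every vertex has one neighbour outside its slice. If two slices meet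
  both \<open>X\<close> and \<open>Y\<close>, induction with \<open>h - 1\<close> in each of them yields enough crossing edges. If at most
  one does and both sides contain whole slices, the edges between those slices are enough.
  Otherwise one side lies in a single slice. If this happens for every \<open>q\<close>, it is always the same
  side, so that side is a set of \<open>t + 1\<close> vertices in a clique, with \<open>h \<le> t \<le> m\<close> and at least
  \<open>(t + 1) (m + d - t)\<close> outgoing edges. This is minimal at \<open>t = h\<close> or \<open>t = m\<close>, and both cliques
  realise their value when they are the optimum.
\<close>

section \<open>Crossing pairs, fibers and operations on k-permutations\<close>

text \<open>Ordered pairs instead of two-element sets make the cardinality a sum of neighbour counts
  over \<open>X\<close>. For disjoint \<open>X\<close> and \<open>Y\<close> no edge is counted
  twice.\<close>

definition cross :: "nat \<Rightarrow> nat \<Rightarrow> nat list set \<Rightarrow> nat list set \<Rightarrow> (nat list \<times> nat list) set" where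
  "cross n k X Y = {(x, y). x \<in> X \<and> y \<in> Y \<and> y \<in> star_neighbours n k x}"

text \<open>Only the positions in \<open>insert 0 F\<close> vary; \<open>0 \<notin> F\<close> throughout.\<close>

definition fiber :: "nat \<Rightarrow> nat \<Rightarrow> nat set \<Rightarrow> nat list \<Rightarrow> nat list set" where
  "fiber n k F p = {x \<in> k_permutations n k. \<forall>i\<in>{1..<k} - F. x ! i = p ! i}"

text \<open>For \<open>p\<close> in \<open>k_permutations n k\<close> and \<open>F\<close> within
  \<open>{1..<k}\<close>, these are exactly the symbols that members of the fiber can carry at any
  given varying position, so they index the slices.\<close>

definition free_symbols :: "nat \<Rightarrow> nat \<Rightarrow> nat set \<Rightarrow> nat list \<Rightarrow> nat set" where
  "free_symbols n k F p = {1..n} - (!) p ` ({1..<k} - F)"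

lemma finite_k_permutations: "finite (k_permutations n k)"
  by (rule finite_subset[OF _ finite_lists_length_eq[of "{1..n}" k]])
    (auto simp: k_permutations_def)

text \<open>Preimages of distinct values are disjoint. This adds up crossing pairs sorted by the
  slices they join.\<close>

lemma sum_card_preimages_le:
  assumes "finite E" "finite I"
  shows "(\<Sum>i\<in>I. card {e \<in> E. f e = i}) \<le> card E"
proof -
  have "(\<Sum>i\<in>I. card {e \<in> E. f e = i}) = card (\<Union>i\<in>I. {e \<in> E. f e = i})"
    using assms by (subst card_UN_disjoint) auto
  also have "\<dots> \<le> card E"
    using assms by (intro card_mono) auto
  finally show ?thesis .
qed

lemma list_update_in_k_permutations:
  assumes "p \<in> k_permutations n k" "j < k" "a \<in> {1..n} - set p"
  shows "p[j := a] \<in> k_permutations n k"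
  using assms set_update_subset_insert[of p j a]
  by (auto simp: k_permutations_def intro: distinct_list_update)

lemma swap_in_k_permutations:
  assumes "p \<in> k_permutations n k" "i < k" "j < k"
  shows "p[i := p ! j, j := p ! i] \<in> k_permutations n k"
  using assms by (auto simp: k_permutations_def)

text \<open>If \<open>a\<close> occurs in \<open>p\<close>, exchange it with the symbol at
  \<open>j\<close>; otherwise overwrite that symbol. Only \<open>j\<close> and the old place of
  \<open>a\<close> are affected.\<close>

lemma move_symbol:
  assumes p: "p \<in> k_permutations n k" and j: "j < k" and a: "a \<in> {1..n}"
  obtains q where "q \<in> k_permutations n k" "q ! j = a"
    "\<And>i. i < k \<Longrightarrow> i \<noteq> j \<Longrightarrow> p ! i \<noteq> a \<Longrightarrow> q ! i = p ! i"
proof (cases "a \<in> set p")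
  case True
  have len: "length p = k" using p by (simp add: k_permutations_def)
  obtain r where r: "r < k" "p ! r = a" using True len by (metis in_set_conv_nth)
  show ?thesis
  proof (rule that)
    show "p[j := p ! r, r := p ! j] \<in> k_permutations n k"
      by (rule swap_in_k_permutations[OF p j r(1)])
  qed (use r j len in \<open>auto simp: nth_list_update\<close>)
next
  case False
  show ?thesis
    by (rule that[of "p[j := a]"])
      (use p j a False list_update_in_k_permutations[OF p j] in \<open>auto simp: k_permutations_def\<close>)
qed

section \<open>Arithmetic of the cut value\<close>

text \<open>The minimum of \<open>(t + 1) * (m + d - t)\<close> over \<open>h \<le> t \<le> m\<close>, for \<open>h \<le> m\<close>.\<close>

definition cut_value :: "nat \<Rightarrow> nat \<Rightarrow> nat \<Rightarrow> nat" where
  "cut_value m d h = (if h < d then (m + d - h) * (h + 1) else (m + 1) * d)"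

text \<open>Serves the case of two slices that meet both sides. For \<open>h < d\<close>, lowering
  both \<open>d\<close> and \<open>h\<close> keeps the factor \<open>m + d - h\<close>, and
  \<open>h + 1 \<le> 2 * h\<close>; otherwise \<open>d \<le> 2 * (d - 1)\<close> suffices.\<close>

lemma cut_value_le_double:
  assumes "2 \<le> d" "1 \<le> h" "h \<le> m"
  shows "cut_value m d h \<le> 2 * cut_value m (d - 1) (h - 1)"
proof -
  obtain d' h' where d: "d = Suc d'" "h = Suc h'"
    using assms by (metis One_nat_def Suc_1 Suc_le_D Suc_le_lessD less_imp_Suc_add)
  show ?thesis
  proof (cases "h < d")
    case True
    have "(m + d' - h') * (h' + 2) \<le> (m + d' - h') * (2 * (h' + 1))"
      by (intro mult_le_mono) auto
    moreover have "cut_value m d h = (m + d' - h') * (h' + 2)"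
      using True d by (simp add: cut_value_def)
    moreover have "2 * cut_value m (d - 1) (h - 1) = (m + d' - h') * (2 * (h' + 1))"
      using True d by (simp add: cut_value_def)
    ultimately show ?thesis by simp
  next
    case False
    have "(m + 1) * (d' + 1) \<le> (m + 1) * (2 * d')"
      using assms d by (intro mult_le_mono) auto
    then show ?thesis using False d by (simp add: cut_value_def algebra_simps)
  qed
qed

text \<open>Serves the case of at most one mixed slice: at least \<open>m + d - 1\<close> pairs of
  whole slices then lie on opposite sides, joined by at least \<open>m + 1\<close> edges
  each.\<close>

lemma cut_value_le_slices:
  assumes "2 \<le> d" "1 \<le> h" "h \<le> m"
  shows "cut_value m d h \<le> (m + 1) * (m + d - 1)"
proof (cases "h < d")
  case True
  have "(m + d - h) * (h + 1) \<le> (m + d - 1) * (m + 1)"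
    using assms by (intro mult_le_mono) auto
  then show ?thesis using True by (simp add: cut_value_def mult.commute)
next
  case False
  have "(m + 1) * d \<le> (m + 1) * (m + d - 1)"
    using assms by (intro mult_le_mono) auto
  then show ?thesis using False by (simp add: cut_value_def)
qed

text \<open>The right-hand side is concave in \<open>c\<close>, hence minimal at
  \<open>c = h + 1\<close> or \<open>c = m + 1\<close>. The first of these values minus the second
  is \<open>(m - h) * (h + 1 - d)\<close> over the integers, so \<open>h < d\<close> decides which
  is smaller.\<close>

lemma cut_value_le_clique:
  assumes "h + 1 \<le> c" "c \<le> m + 1"
  shows "cut_value m d h \<le> c * (m + d + 1 - c)"
proof -
  \<comment> \<open>Slack variables eliminate truncated subtraction; the two sides then differ by a
    polynomial with nonnegative coefficients.\<close>
  obtain v where c: "c = h + 1 + v" using assms(1) le_iff_add by blast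
  obtain u where m: "m = h + v + u" using assms(2) c le_iff_add by auto
  show ?thesis
  proof (cases "h < d")
    case True
    then obtain w where "d = h + 1 + w" by (metis Suc_eq_plus1 Suc_leI le_iff_add)
    then show ?thesis using True c m by (simp add: cut_value_def algebra_simps)
  next
    case False
    then obtain z where z: "h = d + z" by (metis le_iff_add not_less)
    have "(m + 1) * d \<le> c * (u + d)" unfolding c m z by (simp add: algebra_simps)
    then show ?thesis using False c m by (simp add: cut_value_def)
  qed
qed

section \<open>Adjacency and counting crossing pairs\<close>

locale star_parameters =
  fixes n k :: nat
  assumes k_pos: "1 \<le> k" and k_less: "k < n"
begin

abbreviation "P \<equiv> k_permutations n k"
abbreviation "nbr \<equiv> star_neighbours n k"

lemma finite_fiber: "finite (fiber n k F p)"
  using finite_k_permutations by (simp add: fiber_def)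

lemma nbr_sym: "x \<in> P \<Longrightarrow> y \<in> nbr x \<Longrightarrow> x \<in> nbr y"
  using star_neighbours_closed[OF _ _ k_pos] by blast

lemma nbr_irrefl: "x \<in> P \<Longrightarrow> x \<notin> nbr x"
  using star_neighbours_closed[OF _ _ k_pos] by blast

lemma nbr_subset: "x \<in> P \<Longrightarrow> nbr x \<subseteq> P"
  using star_neighbours_closed[OF _ _ k_pos] by blast

lemma finite_nbr: "x \<in> P \<Longrightarrow> finite (nbr x)"
  using nbr_subset finite_k_permutations finite_subset by blast

lemma finite_cross: "finite X \<Longrightarrow> finite Y \<Longrightarrow> finite (cross n k X Y)"
  by (rule finite_subset[of _ "X \<times> Y"]) (auto simp: cross_def)

lemma card_cross_commute:
  assumes "X \<subseteq> P" "Y \<subseteq> P"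
  shows "card (cross n k Y X) = card (cross n k X Y)"
proof -
  have "cross n k Y X = prod.swap ` cross n k X Y"
    using assms nbr_sym by (auto simp: cross_def image_iff)
  then show ?thesis by (simp add: card_image)
qed

lemma card_cross_eq_sum:
  assumes "finite X" "finite Y"
  shows "card (cross n k X Y) = (\<Sum>x\<in>X. card (nbr x \<inter> Y))"
proof -
  have "cross n k X Y = (SIGMA x:X. nbr x \<inter> Y)"
    by (auto simp: cross_def)
  then show ?thesis using assms by (simp add: card_SigmaI)
qed

section \<open>Fibers, free symbols and slices\<close>

lemma fiber_self: "p \<in> P \<Longrightarrow> p \<in> fiber n k F p"
  by (simp add: fiber_def)

lemma fiber_subset: "fiber n k F p \<subseteq> P"
  by (auto simp: fiber_def)

lemma finite_free_symbols: "finite (free_symbols n k F p)"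
  by (simp add: free_symbols_def)

lemma card_free_symbols:
  assumes "p \<in> P" "F \<subseteq> {1..<k}"
  shows "card (free_symbols n k F p) = n - k + card F + 1"
proof -
  have p: "length p = k" "distinct p" "set p \<subseteq> {1..n}"
    using assms by (auto simp: k_permutations_def)
  have "finite F" using assms(2) finite_subset by blast
  have "inj_on ((!) p) ({1..<k} - F)"
    using p by (auto simp: inj_on_def nth_eq_iff_index_eq)
  then have "card ((!) p ` ({1..<k} - F)) = k - 1 - card F"
    using \<open>finite F\<close> assms(2) by (simp add: card_image card_Diff_subset)
  moreover have "(!) p ` ({1..<k} - F) \<subseteq> {1..n}"
    using p by (auto dest: nth_mem)
  ultimately have "card (free_symbols n k F p) = n - (k - 1 - card F)"
    by (simp add: free_symbols_def card_Diff_subset)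
  moreover have "card F \<le> k - 1"
    using card_mono[OF _ assms(2)] by simp
  ultimately show ?thesis using k_pos k_less by linarith
qed

lemma free_symbols_nth:
  assumes x: "x \<in> fiber n k F p" and q: "q \<in> insert 0 F" "F \<subseteq> {1..<k}"
  shows "x ! q \<in> free_symbols n k F p"
proof -
  have x': "length x = k" "distinct x" "set x \<subseteq> {1..n}"
    using x by (auto simp: fiber_def k_permutations_def)
  have qk: "q < k" using q k_pos by auto
  have "x ! q \<in> {1..n}" using x' qk nth_mem by blast
  moreover have "x ! q \<notin> (!) p ` ({1..<k} - F)"
  proof
    assume "x ! q \<in> (!) p ` ({1..<k} - F)"
    then obtain i where i: "i \<in> {1..<k} - F" "x ! q = p ! i" by blast
    then have "x ! i = x ! q" using x by (simp add: fiber_def)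
    moreover have "i < k" using i by simp
    ultimately have "i = q" using x' qk nth_eq_iff_index_eq by blast
    then show False using i q by auto
  qed
  ultimately show ?thesis by (simp add: free_symbols_def)
qed

text \<open>A free symbol occupies no frozen position, so moving it to a varying position never
  leaves the fiber.\<close>

lemma fiber_move_symbol:
  assumes "p \<in> P" "x \<in> fiber n k F p" "j \<in> insert 0 F" "F \<subseteq> {1..<k}" "a \<in> free_symbols n k F p"
  obtains y where "y \<in> fiber n k F p" "y ! j = a"
    "\<And>i. i < k \<Longrightarrow> i \<noteq> j \<Longrightarrow> x ! i \<noteq> a \<Longrightarrow> y ! i = x ! i"
proof -
  have jk: "j < k" using assms k_pos by auto
  have xP: "x \<in> P" using assms(2) fiber_subset by blast
  have "a \<in> {1..n}" using assms(5) by (simp add: free_symbols_def)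
  then obtain y where y: "y \<in> P" "y ! j = a"
    "\<And>i. i < k \<Longrightarrow> i \<noteq> j \<Longrightarrow> x ! i \<noteq> a \<Longrightarrow> y ! i = x ! i"
    using move_symbol[OF xP jk] by metis
  have "y ! i = p ! i" if i: "i \<in> {1..<k} - F" for i
  proof -
    have "x ! i = p ! i" using assms(2) i by (simp add: fiber_def)
    moreover have "p ! i \<noteq> a" using assms(5) i by (auto simp: free_symbols_def)
    moreover have "i \<noteq> j" using i assms(3) by auto
    ultimately show ?thesis using y(3)[of i] i by auto
  qed
  then have "y \<in> fiber n k F p" using y(1) by (simp add: fiber_def)
  then show ?thesis using that y by blast
qed

text \<open>Move \<open>a\<close> to \<open>i\<close>, then \<open>b\<close> to \<open>j\<close>;
  since \<open>a \<noteq> b\<close>, the second move leaves position \<open>i\<close> alone.\<close>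

lemma fiber_two_symbols:
  assumes "p \<in> P" "F \<subseteq> {1..<k}" "i \<in> insert 0 F" "j \<in> insert 0 F" "i \<noteq> j"
    "a \<in> free_symbols n k F p" "b \<in> free_symbols n k F p" "a \<noteq> b"
  obtains x where "x \<in> fiber n k F p" "x ! i = a" "x ! j = b"
proof -
  obtain y where y: "y \<in> fiber n k F p" "y ! i = a"
    using fiber_move_symbol[OF assms(1) fiber_self[OF assms(1)] assms(3,2,6)] by metis
  obtain x where x: "x \<in> fiber n k F p" "x ! j = b"
    "\<And>i. i < k \<Longrightarrow> i \<noteq> j \<Longrightarrow> y ! i \<noteq> b \<Longrightarrow> x ! i = y ! i"
    using fiber_move_symbol[OF assms(1) y(1) assms(4,2,7)] by metis
  have "i < k" using assms(2,3) k_pos by auto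
  then have "x ! i = a" using x(3)[of i] y assms by auto
  then show ?thesis using that x by blast
qed

lemma slice_nonempty:
  assumes "p \<in> P" "F \<subseteq> {1..<k}" "q \<in> F" "a \<in> free_symbols n k F p"
  shows "{x \<in> fiber n k F p. x ! q = a} \<noteq> {}"
proof -
  obtain y where "y \<in> fiber n k F p" "y ! q = a"
    using fiber_move_symbol[OF assms(1) fiber_self[OF assms(1)] _ assms(2,4), of q] assms(3)
    by (metis insertCI)
  then show ?thesis by blast
qed

lemma slice_eq_fiber:
  assumes "x \<in> fiber n k F p" "q \<in> F" "F \<subseteq> {1..<k}"
  shows "{y \<in> fiber n k F p. y ! q = x ! q} = fiber n k (F - {q}) x"
proof -
  have "{1..<k} - (F - {q}) = insert q ({1..<k} - F)" using assms by auto
  moreover have "x ! i = p ! i" if "i \<in> {1..<k} - F" for i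
    using assms(1) that by (simp add: fiber_def)
  ultimately show ?thesis by (auto simp: fiber_def)
qed

text \<open>The admissible \<open>a\<close> include the current symbol \<open>x ! r\<close>, which
  yields \<open>x\<close> itself; by \<open>card_symbols_except\<close> there are
  \<open>n - k + 1\<close> of them.\<close>

lemma update_fiber:
  assumes x: "x \<in> fiber n k F p" and r: "r \<in> insert 0 F" and F: "F \<subseteq> {1..<k}"
    and a: "a \<in> {1..n} - (!) x ` ({..<k} - {r})"
  shows "x[r := a] \<in> fiber n k F p"
proof -
  have x': "x \<in> P" "length x = k" using x by (auto simp: fiber_def k_permutations_def)
  have rk: "r < k" using r F k_pos by auto
  have "x[r := a] \<in> P"
  proof (cases "a = x ! r")
    case True
    then show ?thesis using x' by simp
  next
    case False
    have "a \<notin> set x"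
    proof
      assume "a \<in> set x"
      then obtain i where "i < k" "x ! i = a" using x' by (metis in_set_conv_nth)
      then show False using a False by auto
    qed
    then show ?thesis using list_update_in_k_permutations[OF x'(1) rk] a by auto
  qed
  moreover have "x[r := a] ! i = p ! i" if "i \<in> {1..<k} - F" for i
  proof -
    have "i \<noteq> r" using that r by auto
    then show ?thesis using that x by (simp add: fiber_def)
  qed
  ultimately show ?thesis by (simp add: fiber_def)
qed

lemma card_symbols_except:
  assumes "x \<in> P" "r < k"
  shows "card ({1..n} - (!) x ` ({..<k} - {r})) = n - k + 1"
proof -
  have x: "length x = k" "distinct x" "set x \<subseteq> {1..n}"
    using assms by (auto simp: k_permutations_def)
  have "inj_on ((!) x) ({..<k} - {r})"
    using x by (auto simp: inj_on_def nth_eq_iff_index_eq)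
  then have "card ((!) x ` ({..<k} - {r})) = k - 1"
    using assms(2) by (simp add: card_image)
  moreover have "(!) x ` ({..<k} - {r}) \<subseteq> {1..n}"
    using x by (auto dest: nth_mem)
  ultimately show ?thesis using k_less k_pos by (simp add: card_Diff_subset)
qed

text \<open>An edge from slice \<open>a\<close> to slice \<open>b\<close> swaps positions 0 and
  \<open>q\<close>, so these vertices are its possible starting points. A further varying position,
  if there is one, can be refilled in \<open>n - k + 1\<close> ways.\<close>

lemma card_two_symbols:
  assumes p: "p \<in> P" and F: "F \<subseteq> {1..<k}" and q: "q \<in> F"
    and a: "a \<in> free_symbols n k F p" and b: "b \<in> free_symbols n k F p" and ab: "a \<noteq> b"
  shows "(if F = {q} then 1 else n - k + 1) \<le> card {x \<in> fiber n k F p. x ! q = a \<and> x ! 0 = b}"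
    (is "_ \<le> card ?S")
proof -
  have fin: "finite ?S" using finite_fiber by simp
  have q0: "q \<noteq> 0" using q F by auto
  obtain x where x: "x \<in> fiber n k F p" "x ! q = a" "x ! 0 = b"
    using fiber_two_symbols[OF p F _ _ q0 a b ab] q by auto
  show ?thesis
  proof (cases "F = {q}")
    case True
    have "?S \<noteq> {}" using x by blast
    then show ?thesis using True fin by (simp add: Suc_leI card_gt_0_iff)
  next
    case False
    then obtain r where r: "r \<in> F" "r \<noteq> q" using q by blast
    have r': "r < k" "r \<noteq> 0" using r F by auto
    have xP: "x \<in> P" "length x = k" using x fiber_subset by (auto simp: fiber_def k_permutations_def)
    let ?C = "{1..n} - (!) x ` ({..<k} - {r})"
    have "(\<lambda>c. x[r := c]) ` ?C \<subseteq> ?S"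
      using update_fiber[OF x(1) _ F, of r] r r' x by auto
    moreover have "inj_on (\<lambda>c. x[r := c]) ?C"
      by (rule inj_on_inverseI[where g = "\<lambda>y. y ! r"]) (use r' xP in simp)
    ultimately have "card ?C \<le> card ?S" by (intro card_inj_on_le[OF _ _ fin])
    then show ?thesis using False card_symbols_except[OF xP(1) r'(1)] by simp
  qed
qed

section \<open>Neighbourhoods inside a fiber\<close>

lemma swap_in_fiber:
  assumes "x \<in> fiber n k F p" "i \<in> F" "F \<subseteq> {1..<k}"
  shows "x[0 := x ! i, i := x ! 0] \<in> fiber n k F p \<inter> nbr x"
proof -
  have xP: "x \<in> P" using assms fiber_subset by blast
  have i: "1 \<le> i" "i < k" using assms by auto
  have "x[0 := x ! i, i := x ! 0] \<in> P" using swap_in_k_permutations[OF xP, of 0 i] i by simp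
  moreover have "x[0 := x ! i, i := x ! 0] ! j = p ! j" if "j \<in> {1..<k} - F" for j
  proof -
    have "j \<noteq> 0" "j \<noteq> i" using that assms by auto
    then show ?thesis using that assms by (simp add: fiber_def)
  qed
  moreover have "x[0 := x ! i, i := x ! 0] \<in> nbr x" using i unfolding star_neighbours_def by blast
  ultimately show ?thesis by (simp add: fiber_def)
qed

text \<open>Position \<open>q\<close> changes only under the swap with \<open>q\<close>. Hence a
  vertex has at most one neighbour outside its slice.\<close>

lemma nbr_leaving_slice:
  assumes "x \<in> P" "y \<in> nbr x" "q \<in> {1..<k}" "y ! q \<noteq> x ! q"
  shows "y = x[0 := x ! q, q := x ! 0]"
proof -
  from assms(2) consider (s) i where "y = x[0 := x ! i, i := x ! 0]" "1 \<le> i" "i < k"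
    | (r) a where "y = x[0 := a]" unfolding star_neighbours_def by blast
  then show ?thesis
  proof cases
    case s
    have "q = i" using assms(3,4) s by (cases "q = i") auto
    then show ?thesis using s by simp
  next
    case r
    then show ?thesis using assms by auto
  qed
qed

text \<open>Swaps with positions in \<open>F\<close> and replacements of the first symbol stay in
  the fiber. All of them are told apart by the new first symbol, which lies in \<open>set x\<close>
  for a swap and outside it for a replacement.\<close>

lemma card_nbr_fiber:
  assumes x: "x \<in> fiber n k F p" and F: "F \<subseteq> {1..<k}"
  shows "n - k + card F \<le> card (nbr x \<inter> fiber n k F p)"
proof -
  have x': "x \<in> P" "length x = k" "distinct x" "set x \<subseteq> {1..n}"
    using x by (auto simp: fiber_def k_permutations_def)
  have finF: "finite F" using F finite_subset by blast
  let ?s = "\<lambda>i. x[0 := x ! i, i := x ! 0]" and ?r = "\<lambda>a. x[0 := a]"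
  let ?A = "{1..n} - set x"
  have cA: "card ?A = n - k"
    using x' by (simp add: card_Diff_subset distinct_card)
  have s0: "?s i ! 0 = x ! i" if "i \<in> F" for i
  proof -
    have "i \<noteq> 0" using that F by auto
    then show ?thesis using x' k_pos by simp
  qed
  have r0: "?r a ! 0 = a" for a using x' k_pos by simp
  have "inj_on ?s F"
  proof (rule inj_onI)
    fix i j assume "i \<in> F" "j \<in> F" "?s i = ?s j"
    then have "x ! i = x ! j" using s0 by metis
    moreover have "i < k" "j < k" using \<open>i \<in> F\<close> \<open>j \<in> F\<close> F by auto
    ultimately show "i = j" using x' nth_eq_iff_index_eq by blast
  qed
  moreover have "inj_on ?r ?A"
    by (rule inj_on_inverseI[where g = "\<lambda>y. y ! 0"]) (rule r0)
  moreover have "?s ` F \<inter> ?r ` ?A = {}"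
  proof -
    have "?s i \<noteq> ?r a" if "i \<in> F" "a \<in> ?A" for i a
    proof -
      have "x ! i \<in> set x" using that F x' by (auto intro: nth_mem)
      then have "?s i ! 0 \<noteq> ?r a ! 0" using s0[OF that(1)] r0[of a] that by auto
      then show ?thesis by auto
    qed
    then show ?thesis by blast
  qed
  ultimately have "card (?s ` F \<union> ?r ` ?A) = card F + (n - k)"
    using finF cA by (simp add: card_Un_disjoint card_image)
  moreover have "?s ` F \<union> ?r ` ?A \<subseteq> nbr x \<inter> fiber n k F p"
  proof -
    have "?r a \<in> nbr x \<inter> fiber n k F p" if "a \<in> ?A" for a
    proof -
      have "?r a \<in> nbr x" using that unfolding star_neighbours_def by blast
      moreover have "a \<in> {1..n} - (!) x ` ({..<k} - {0})" using that x' by auto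
      ultimately show ?thesis using update_fiber[OF x _ F, of 0 a] by simp
    qed
    then show ?thesis using swap_in_fiber[OF x _ F] by blast
  qed
  ultimately show ?thesis
    using card_mono[of "nbr x \<inter> fiber n k F p" "?s ` F \<union> ?r ` ?A"] finite_fiber by simp
qed

text \<open>The two families of neighbours give the upper bound; \<open>card_nbr_fiber\<close> with
  every position varying gives the lower one.\<close>

lemma card_nbr:
  assumes "x \<in> P"
  shows "card (nbr x) = n - 1"
proof -
  have x': "length x = k" "distinct x" "set x \<subseteq> {1..n}"
    using assms by (auto simp: k_permutations_def)
  have "nbr x = (\<lambda>i. x[0 := x ! i, i := x ! 0]) ` {1..<k} \<union> (\<lambda>a. x[0 := a]) ` ({1..n} - set x)"
    unfolding star_neighbours_def by auto
  then have "card (nbr x) \<le> card {1..<k} + card ({1..n} - set x)"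
    by (simp only:) (intro order_trans[OF card_Un_le] add_mono card_image_le; simp)
  also have "\<dots> = n - 1"
    using x' k_pos k_less by (simp add: card_Diff_subset distinct_card)
  finally have "card (nbr x) \<le> n - 1" .
  moreover have "n - k + card {1..<k} \<le> card (nbr x)"
    using card_nbr_fiber[OF fiber_self[OF assms], of "{1..<k}"] finite_nbr[OF assms]
      card_mono[of "nbr x" "nbr x \<inter> fiber n k {1..<k} x"] by fastforce
  ultimately show ?thesis using k_pos k_less by simp
qed

section \<open>Counting crossing pairs slice by slice\<close>

text \<open>Call a slice mixed if it meets both sides; \<open>M\<close> bounds the crossing pairs
  inside one, and \<open>w\<close> those between two whole slices on opposite sides. The three
  disjuncts arise from at least two, exactly one and no mixed slice.\<close>

lemma slice_cases:
  fixes X Y :: "nat list set"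
  assumes p: "p \<in> P" and F: "F \<subseteq> {1..<k}" and q: "q \<in> F"
    and V: "X \<union> Y = fiber n k F p" and disj: "X \<inter> Y = {}"
    and X_wide: "\<nexists>a. X \<subseteq> {x. x ! q = a}" and Y_wide: "\<nexists>a. Y \<subseteq> {x. x ! q = a}"
    and M: "\<And>a. a \<in> free_symbols n k F p \<Longrightarrow> {x \<in> X. x ! q = a} \<noteq> {} \<Longrightarrow> {x \<in> Y. x ! q = a} \<noteq> {} \<Longrightarrow>
      M \<le> card (cross n k {x \<in> X. x ! q = a} {x \<in> Y. x ! q = a})"
  defines "w \<equiv> if F = {q} then 1 else n - k + 1"
  shows "2 * M \<le> card (cross n k X Y) \<or> w * (n - k + card F - 1) + M \<le> card (cross n k X Y) \<or>
    w * (n - k + card F) \<le> card (cross n k X Y)"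
proof -
  define E where "E = cross n k X Y"
  define A where "A = free_symbols n k F p"
  define S where "S a = {x \<in> fiber n k F p. x ! q = a}" for a
  \<comment> \<open>Sorts a crossing pair by the slices of its endpoints.\<close>
  define f where "f = (\<lambda>(x :: nat list, y :: nat list). (x ! q, y ! q))"
  define AX where "AX = {a \<in> A. S a \<subseteq> X}"
  define AY where "AY = {a \<in> A. S a \<subseteq> Y}"
  define C where "C = {a \<in> A. S a \<inter> X \<noteq> {} \<and> S a \<inter> Y \<noteq> {}}"
  have "finite X" "finite Y" using V finite_fiber by (metis finite_Un)+
  then have finE: "finite E" by (simp add: E_def finite_cross)
  have finA: "finite A" by (simp add: A_def finite_free_symbols)
  have S_ne: "S a \<noteq> {}" if "a \<in> A" for a
    using slice_nonempty[OF p F q] that by (simp add: S_def A_def)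
  have S_sub: "S a \<subseteq> X \<union> Y" for a using V by (auto simp: S_def)
  have symbol: "x ! q \<in> A \<and> x \<in> S (x ! q)" if "x \<in> X \<union> Y" for x
    using free_symbols_nth[of x F p q] that V q F by (simp add: A_def S_def)
  have A_eq: "A = AX \<union> AY \<union> C" using S_sub by (fastforce simp: AX_def AY_def C_def)
  have AXY: "AX \<inter> AY = {}" using S_ne disj by (fastforce simp: AX_def AY_def)
  have AXC: "(AX \<union> AY) \<inter> C = {}" using disj by (fastforce simp: AX_def AY_def C_def)
  have fin: "finite AX" "finite AY" "finite C" using finA A_eq by auto
  have "card A = card AX + card AY + card C"
    using A_eq AXY AXC fin by (simp add: card_Un_disjoint)
  then have cards: "card AX + card AY + card C = n - k + card F + 1"
    using card_free_symbols[OF p F] by (simp add: A_def)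
  have inner: "M \<le> card {e \<in> E. f e = (a, a)}" if "a \<in> C" for a
  proof -
    have "cross n k {x \<in> X. x ! q = a} {x \<in> Y. x ! q = a} = {e \<in> E. f e = (a, a)}"
      by (auto simp: E_def f_def cross_def)
    then show ?thesis using M[of a] that by (auto simp: C_def A_def S_def)
  qed
  \<comment> \<open>A vertex of slice \<open>a\<close> with \<open>b\<close> at position 0 is taken
    into slice \<open>b\<close> by the swap with \<open>q\<close>.\<close>
  have outer: "w \<le> card {e \<in> E. f e = (a, b)}" if a: "a \<in> AX" and b: "b \<in> AY" for a b
  proof -
    have ab: "a \<noteq> b" using AXY a b by auto
    have abA: "a \<in> A" "b \<in> A" using a b by (auto simp: AX_def AY_def)
    let ?T = "{x \<in> fiber n k F p. x ! q = a \<and> x ! 0 = b}"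
    let ?s = "\<lambda>x. (x, x[0 := x ! q, q := x ! 0])"
    have "?s x \<in> {e \<in> E. f e = (a, b)}" if x: "x \<in> ?T" for x
    proof -
      let ?y = "x[0 := x ! q, q := x ! 0]"
      have y: "?y \<in> fiber n k F p" "?y \<in> nbr x" using swap_in_fiber[OF _ q F] x by blast+
      have "length x = k" using x by (auto simp: fiber_def k_permutations_def)
      then have "?y ! q = b" using q F x by auto
      then have "?y \<in> Y" "x \<in> X" using y x a b by (auto simp: AX_def AY_def S_def)
      then show ?thesis using y x \<open>?y ! q = b\<close> by (simp add: E_def f_def cross_def)
    qed
    then have image: "?s ` ?T \<subseteq> {e \<in> E. f e = (a, b)}" by blast
    have inj: "inj_on ?s ?T" by (rule inj_onI) simp
    have "card ?T \<le> card {e \<in> E. f e = (a, b)}"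
      by (rule card_inj_on_le[OF inj image]) (simp add: finE)
    then show ?thesis
      using card_two_symbols[OF p F q, of a b] abA ab by (simp add: w_def A_def)
  qed
  have rect: "w * (card AX * card AY) \<le> (\<Sum>i\<in>AX \<times> AY. card {e \<in> E. f e = i})"
  proof -
    have "(\<Sum>i\<in>AX \<times> AY. w) \<le> (\<Sum>i\<in>AX \<times> AY. card {e \<in> E. f e = i})"
      using outer by (intro sum_mono) auto
    then show ?thesis by (simp add: card_cartesian_product mult.commute)
  qed
  \<comment> \<open>This is \<open>(s - 1) * (t - 1) \<ge> 0\<close> for positive integers
    \<open>s\<close> and \<open>t\<close>.\<close>
  have prod_ge: "card AX + card AY - 1 \<le> card AX * card AY" if "AX \<noteq> {}" "AY \<noteq> {}"
  proof -
    have "card AX \<noteq> 0" "card AY \<noteq> 0" using that fin by auto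
    then obtain s t where "card AX = Suc s" "card AY = Suc t" by (meson not0_implies_Suc)
    then show ?thesis by simp
  qed
  show ?thesis
  proof (cases "\<exists>a\<in>C. \<exists>b\<in>C. a \<noteq> b")
    case True
    then obtain a b where ab: "a \<in> C" "b \<in> C" "a \<noteq> b" by blast
    have "(\<Sum>i\<in>{(a, a), (b, b)}. card {e \<in> E. f e = i}) \<le> card E"
      by (rule sum_card_preimages_le[OF finE]) simp
    then have "2 * M \<le> card E" using inner[OF ab(1)] inner[OF ab(2)] ab(3) by simp
    then show ?thesis by (simp add: E_def)
  next
    case False
    \<comment> \<open>Without a slice inside \<open>X\<close>, all of \<open>X\<close> would lie in
      mixed slices. At most one exists, so \<open>X\<close> would be constant at
      \<open>q\<close>.\<close>
    have AX_ne: "AX \<noteq> {}"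
    proof
      assume "AX = {}"
      have "x ! q \<in> C" if "x \<in> X" for x
        using symbol[of x] that A_eq \<open>AX = {}\<close> disj by (fastforce simp: AY_def)
      then show False using X_wide False by blast
    qed
    have AY_ne: "AY \<noteq> {}"
    proof
      assume "AY = {}"
      have "x ! q \<in> C" if "x \<in> Y" for x
        using symbol[of x] that A_eq \<open>AY = {}\<close> disj by (fastforce simp: AX_def)
      then show False using Y_wide False by blast
    qed
    show ?thesis
    proof (cases "C = {}")
      case True
      then have "w * (n - k + card F) \<le> w * (card AX * card AY)"
        using prod_ge[OF AX_ne AY_ne] cards by simp
      also have "\<dots> \<le> card E"
        using rect sum_card_preimages_le[OF finE, of "AX \<times> AY" f] fin by simp
      finally show ?thesis by (simp add: E_def)
    next
      case False
      then obtain c where c: "C = {c}" using \<open>\<not> (\<exists>a\<in>C. \<exists>b\<in>C. a \<noteq> b)\<close> by blast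
      \<comment> \<open>The mixed slice \<open>c\<close> reduces the number of whole slices by one,
        but its inner pairs are counted in addition, since \<open>(c, c)\<close> lies outside
        \<open>AX \<times> AY\<close>.\<close>
      have "w * (n - k + card F - 1) \<le> w * (card AX * card AY)"
        using prod_ge[OF AX_ne AY_ne] cards c by simp
      moreover have "(c, c) \<notin> AX \<times> AY" using AXY by blast
      then have "(\<Sum>i\<in>AX \<times> AY. card {e \<in> E. f e = i}) + card {e \<in> E. f e = (c, c)} \<le> card E"
        using sum_card_preimages_le[OF finE, of "insert (c, c) (AX \<times> AY)" f] fin by simp
      moreover have "M \<le> card {e \<in> E. f e = (c, c)}" using inner[of c] c by simp
      ultimately have "w * (n - k + card F - 1) + M \<le> card E"
        using rect by linarith
      then show ?thesis by (simp add: E_def)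
    qed
  qed
qed

section \<open>Sides confined to a single slice\<close>

text \<open>If \<open>Y\<close> is constant at \<open>q\<close> and \<open>X\<close> at some
  \<open>r \<noteq> q\<close>, a vertex with other symbols at both positions lies on neither side.
  At least three free symbols exist, enough to choose two distinct ones for it.\<close>

lemma narrow_same_side:
  assumes p: "p \<in> P" and F: "F \<subseteq> {1..<k}" and V: "X \<union> Y = fiber n k F p"
    and narrow: "\<And>q. q \<in> F \<Longrightarrow> (\<exists>a. X \<subseteq> {x. x ! q = a}) \<or> (\<exists>a. Y \<subseteq> {x. x ! q = a})"
  shows "(\<forall>q\<in>F. \<exists>a. X \<subseteq> {x. x ! q = a}) \<or> (\<forall>q\<in>F. \<exists>a. Y \<subseteq> {x. x ! q = a})"
proof (rule ccontr)
  assume "\<not> ?thesis"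
  then obtain q r where qr: "q \<in> F" "r \<in> F"
    and no: "\<nexists>a. X \<subseteq> {x. x ! q = a}" "\<nexists>a. Y \<subseteq> {x. x ! r = a}" by blast
  then obtain a b where ab: "Y \<subseteq> {x. x ! q = b}" "X \<subseteq> {x. x ! r = a}" using narrow by meson
  have "q \<noteq> r" using ab no by blast
  let ?A = "free_symbols n k F p"
  have "F \<noteq> {}" "finite F" using qr F finite_subset by auto
  then have "1 \<le> card F" by (simp add: Suc_leI card_gt_0_iff)
  then have "3 \<le> card ?A" using card_free_symbols[OF p F] k_less by simp
  have ex: "\<exists>c\<in>?A. c \<notin> B" if "card B \<le> 2" "finite B" for B
    using card_mono[of B ?A] that \<open>3 \<le> card ?A\<close> by fastforce
  obtain c where c: "c \<in> ?A" "c \<noteq> b" using ex[of "{b}"] by auto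
  have "card {a, c} \<le> 2" by (simp add: card_insert_if)
  then obtain c' where c': "c' \<in> ?A" "c' \<noteq> a" "c' \<noteq> c" using ex[of "{a, c}"] by auto
  obtain x where "x \<in> fiber n k F p" "x ! q = c" "x ! r = c'"
    using fiber_two_symbols[OF p F _ _ \<open>q \<noteq> r\<close> c(1) c'(1)] qr c' by (metis insertCI)
  then show False using V ab c c' by auto
qed

text \<open>All members agree outside position 0, so each is determined by its first symbol, which
  avoids the \<open>k - 1\<close> common symbols.\<close>

lemma card_narrow_le:
  assumes F: "F \<subseteq> {1..<k}" and X: "X \<subseteq> fiber n k F p"
    and narrow: "\<And>q. q \<in> F \<Longrightarrow> \<exists>a. X \<subseteq> {x. x ! q = a}"
  shows "card X \<le> n - k + 1"
proof (cases "X = {}")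
  case False
  then obtain x where x: "x \<in> X" by blast
  then have xP: "x \<in> P" using X fiber_subset by blast
  have agree: "y ! i = x ! i" if "y \<in> X" "i \<in> {1..<k}" for y i
  proof (cases "i \<in> F")
    case True
    then show ?thesis using narrow[OF True] x that by blast
  next
    case False
    then have "y ! i = p ! i" "x ! i = p ! i" using X x that by (auto simp: fiber_def)
    then show ?thesis by simp
  qed
  let ?C = "{1..n} - (!) x ` ({..<k} - {0})"
  have "(\<lambda>y. y ! 0) ` X \<subseteq> ?C"
  proof (intro image_subsetI DiffI)
    fix y assume y: "y \<in> X"
    then have y': "length y = k" "distinct y" "set y \<subseteq> {1..n}"
      using X by (auto simp: fiber_def k_permutations_def)
    show "y ! 0 \<in> {1..n}" using y' k_pos nth_mem[of 0 y] by (metis One_nat_def Suc_le_lessD subsetD)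
    show "y ! 0 \<notin> (!) x ` ({..<k} - {0})"
    proof
      assume "y ! 0 \<in> (!) x ` ({..<k} - {0})"
      then obtain i where i: "i < k" "i \<noteq> 0" "y ! 0 = x ! i" by blast
      then have "y ! 0 = y ! i" using agree[OF y, of i] by simp
      then show False using y' i k_pos nth_eq_iff_index_eq[of y 0 i] by simp
    qed
  qed
  moreover have "inj_on (\<lambda>y. y ! 0) X"
  proof (rule inj_onI)
    fix y z assume yz: "y \<in> X" "z \<in> X" "y ! 0 = z ! 0"
    then have len: "length y = k" "length z = k"
      using X by (auto simp: fiber_def k_permutations_def)
    show "y = z"
    proof (rule nth_equalityI)
      fix i assume "i < length y"
      then show "y ! i = z ! i"
        using yz agree[of y i] agree[of z i] len by (cases "i = 0") auto
    qed (use len in simp)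
  qed
  ultimately have "card X \<le> card ?C" by (intro card_inj_on_le) auto
  then show ?thesis using card_symbols_except[OF xP, of 0] k_pos by simp
qed simp

text \<open>A vertex of \<open>X\<close> has at most \<open>card X - 1\<close> of its neighbours in
  \<open>X\<close>; its other neighbours in the fiber lie in \<open>Y\<close>.\<close>

lemma card_cross_ge_mult:
  assumes F: "F \<subseteq> {1..<k}" and V: "X \<union> Y = fiber n k F p"
  shows "card X * (n - k + card F + 1 - card X) \<le> card (cross n k X Y)"
proof -
  have fin: "finite X" "finite Y" using V finite_fiber by (metis finite_Un)+
  have "n - k + card F + 1 - card X \<le> card (nbr x \<inter> Y)" if x: "x \<in> X" for x
  proof -
    have xV: "x \<in> fiber n k F p" using x V by blast
    then have xP: "x \<in> P" using fiber_subset by blast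
    have "nbr x \<inter> fiber n k F p \<subseteq> (nbr x \<inter> Y) \<union> (X - {x})"
      using V nbr_irrefl[OF xP] by blast
    then have "card (nbr x \<inter> fiber n k F p) \<le> card ((nbr x \<inter> Y) \<union> (X - {x}))"
      using fin by (intro card_mono) auto
    also have "\<dots> \<le> card (nbr x \<inter> Y) + (card X - 1)"
      using card_Un_le[of "nbr x \<inter> Y" "X - {x}"] x fin by simp
    finally have "n - k + card F \<le> card (nbr x \<inter> Y) + (card X - 1)"
      using card_nbr_fiber[OF xV F] by linarith
    moreover have "card X > 0" using x fin by (auto simp: card_gt_0_iff)
    ultimately show ?thesis by linarith
  qed
  then have "(\<Sum>x\<in>X. n - k + card F + 1 - card X) \<le> (\<Sum>x\<in>X. card (nbr x \<inter> Y))"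
    by (rule sum_mono)
  then show ?thesis using card_cross_eq_sum[OF fin] by simp
qed

text \<open>The case split shared by both inductions below: a small side inside a clique, or a
  position at which both sides spread over several slices.\<close>

lemma narrow_cases:
  assumes p: "p \<in> P" and F: "F \<subseteq> {1..<k}" and V: "X \<union> Y = fiber n k F p"
    and X: "(\<And>q. q \<in> F \<Longrightarrow> \<exists>a. X \<subseteq> {x. x ! q = a}) \<Longrightarrow> thesis"
    and Y: "(\<And>q. q \<in> F \<Longrightarrow> \<exists>a. Y \<subseteq> {x. x ! q = a}) \<Longrightarrow> thesis"
    and wide: "\<And>q. q \<in> F \<Longrightarrow> \<nexists>a. X \<subseteq> {x. x ! q = a} \<Longrightarrow> \<nexists>a. Y \<subseteq> {x. x ! q = a} \<Longrightarrow> thesis"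
  shows thesis
proof (cases "\<exists>q\<in>F. (\<nexists>a. X \<subseteq> {x. x ! q = a}) \<and> (\<nexists>a. Y \<subseteq> {x. x ! q = a})")
  case True
  then show ?thesis using wide by blast
next
  case False
  then have "(\<forall>q\<in>F. \<exists>a. X \<subseteq> {x. x ! q = a}) \<or> (\<forall>q\<in>F. \<exists>a. Y \<subseteq> {x. x ! q = a})"
    by (intro narrow_same_side[OF p F V]) blast
  then show ?thesis using X Y by blast
qed

lemma slice_partition:
  assumes F: "F \<subseteq> {1..<k}" and q: "q \<in> F" and V: "X \<union> Y = fiber n k F p"
    and ne: "{x \<in> X. x ! q = a} \<noteq> {}"
  obtains x where "x \<in> P"
    "{x \<in> X. x ! q = a} \<union> {x \<in> Y. x ! q = a} = fiber n k (F - {q}) x"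
proof -
  obtain x where x: "x \<in> X" "x ! q = a" using ne by blast
  then have xV: "x \<in> fiber n k F p" using V by blast
  have "{x \<in> X. x ! q = a} \<union> {x \<in> Y. x ! q = a} = {y \<in> fiber n k F p. y ! q = x ! q}"
    using V x by auto
  then show ?thesis using that slice_eq_fiber[OF xV q F] xV fiber_subset by blast
qed

section \<open>Lower bounds on crossing pairs by induction on the varying positions\<close>

text \<open>
  The case \<open>h = 0\<close> has its own induction: \<^term>\<open>cut_value m 0 h\<close> is 0, which is too weak an induction
  hypothesis for \<open>d = 1\<close>.
\<close>

lemma card_cross_connectivity:
  assumes "p \<in> P" "F \<subseteq> {1..<k}" "X \<union> Y = fiber n k F p" "X \<inter> Y = {}" "X \<noteq> {}" "Y \<noteq> {}"
  shows "n - k + card F \<le> card (cross n k X Y)"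
  using assms
proof (induction "card F" arbitrary: F p X Y)
  case (0 F)
  note p = 0(2) and F = 0(3) and V = 0(4)
  have "F = {}" using 0 finite_subset[OF F] by auto
  have fin: "finite X" "finite Y" using V finite_fiber by (metis finite_Un)+
  \<comment> \<open>The fiber is a clique here. Both factors of the product bound are positive and
    add up to \<open>n - k + 1\<close>, so their product is at least \<open>n - k\<close>.\<close>
  have "card (X \<union> Y) \<le> n - k + 1"
    using card_narrow_le[of F "X \<union> Y" p] V F \<open>F = {}\<close> by simp
  moreover have "card X > 0" "card Y > 0" using fin 0 by (auto simp: card_gt_0_iff)
  ultimately have c: "0 < card X" "card X < n - k + 1"
    using fin \<open>X \<inter> Y = {}\<close> by (simp_all add: card_Un_disjoint)
  have "card X \<noteq> 0" "n - k + 1 - card X \<noteq> 0" using c by simp_all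
  then obtain s t where st: "card X = Suc s" "n - k + 1 - card X = Suc t"
    by (meson not0_implies_Suc)
  have "n - k \<le> Suc s * Suc t" using st by simp
  then show ?case using card_cross_ge_mult[OF F V] st \<open>F = {}\<close> by simp
next
  case (Suc d F)
  note p = \<open>p \<in> P\<close> and F = Suc(4) and V = Suc(5)
  have finF: "finite F" using F finite_subset by blast
  have fin: "finite X" "finite Y" using V finite_fiber by (metis finite_Un)+
  have XP: "X \<subseteq> P" "Y \<subseteq> P" using V fiber_subset by blast+
  \<comment> \<open>The factors have sum \<open>n - k + card F + 1\<close> and are positive, the
    second because \<open>card F \<ge> 1\<close>; their product is at least the sum minus
    one.\<close>
  have bound: "n - k + card F \<le> c * (n - k + card F + 1 - c)" if "1 \<le> c" "c \<le> n - k + 1" for c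
  proof -
    have "c \<noteq> 0" "n - k + card F + 1 - c \<noteq> 0" using that Suc(2) by linarith+
    then obtain s t where s: "c = Suc s" and t: "n - k + card F + 1 - c = Suc t"
      by (meson not0_implies_Suc)
    have "n - k + card F \<le> Suc s * Suc t" using s t by simp
    then show ?thesis using s t by simp
  qed
  have pos: "1 \<le> card X" "1 \<le> card Y" using fin Suc by (auto simp: Suc_le_eq card_gt_0_iff)
  show ?case
  proof (rule narrow_cases[OF p F V])
    assume "\<And>q. q \<in> F \<Longrightarrow> \<exists>a. X \<subseteq> {x. x ! q = a}"
    then have "card X \<le> n - k + 1" using card_narrow_le[OF F, of X p] V by blast
    then show ?thesis using bound[OF pos(1)] card_cross_ge_mult[OF F V] by linarith
  next
    assume "\<And>q. q \<in> F \<Longrightarrow> \<exists>a. Y \<subseteq> {x. x ! q = a}"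
    then have "card Y \<le> n - k + 1" using card_narrow_le[OF F, of Y p] V by blast
    moreover have "Y \<union> X = fiber n k F p" using V by blast
    ultimately show ?thesis
      using bound[OF pos(2)] card_cross_ge_mult[OF F, of Y X p] card_cross_commute[OF XP] by simp
  next
    fix q assume q: "q \<in> F"
      and wide: "\<nexists>a. X \<subseteq> {x. x ! q = a}" "\<nexists>a. Y \<subseteq> {x. x ! q = a}"
    have d: "card (F - {q}) = d" using q Suc(2) finF by simp
    have slice: "n - k + d \<le> card (cross n k {x \<in> X. x ! q = a} {x \<in> Y. x ! q = a})"
      if ne: "{x \<in> X. x ! q = a} \<noteq> {}" "{x \<in> Y. x ! q = a} \<noteq> {}" for a
    proof -
      obtain x where x: "x \<in> P"
        "{x \<in> X. x ! q = a} \<union> {x \<in> Y. x ! q = a} = fiber n k (F - {q}) x"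
        using slice_partition[OF F q V ne(1)] by blast
      have "F - {q} \<subseteq> {1..<k}" "{x \<in> X. x ! q = a} \<inter> {x \<in> Y. x ! q = a} = {}"
        using F \<open>X \<inter> Y = {}\<close> by auto
      then show ?thesis
        using Suc(1)[OF d[symmetric] x(1) _ x(2) _ ne] d by simp
    qed
    define w where "w = (if F = {q} then 1 else n - k + 1)"
    have w: "1 \<le> w" by (simp add: w_def)
    have d': "card F = Suc d" using Suc(2) by simp
    have nk: "n - k \<ge> 1" using k_less by simp
    have w_le: "N \<le> w * N" for N using w by simp
    have "2 * (n - k + d) \<le> card (cross n k X Y) \<or>
        w * (n - k + card F - 1) + (n - k + d) \<le> card (cross n k X Y) \<or>
        w * (n - k + card F) \<le> card (cross n k X Y)"
      unfolding w_def
      by (rule slice_cases[OF p F q V \<open>X \<inter> Y = {}\<close> wide]) (rule slice)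
    moreover define N where "N = n - k + d"
    moreover have N: "n - k + card F = Suc N" using d' by (simp add: N_def)
    ultimately have "2 * N \<le> card (cross n k X Y) \<or> w * N + N \<le> card (cross n k X Y) \<or>
        w * Suc N \<le> card (cross n k X Y)"
      by simp
    \<comment> \<open>The induction hypothesis gives \<open>N\<close> per mixed slice and the goal
      is \<open>Suc N\<close>; \<open>k < n\<close> ensures \<open>N \<ge> 1\<close>.\<close>
    moreover have "Suc N \<le> 2 * N" using nk by (simp add: N_def)
    moreover have "2 * N \<le> w * N + N" using w_le[of N] by linarith
    ultimately show ?thesis unfolding N using w_le[of "Suc N"] by (meson le_trans)
  qed
qed

text \<open>Restricting to a slice costs each vertex at most one neighbour, so the induction
  hypothesis applies there with \<open>h - 1\<close>. The arithmetic lemmas on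
  \<open>cut_value\<close> settle the cases of \<open>narrow_cases\<close> and
  \<open>slice_cases\<close>.\<close>

lemma card_cross_ge_cut_value:
  assumes "p \<in> P" "F \<subseteq> {1..<k}" "X \<union> Y = fiber n k F p" "X \<inter> Y = {}" "X \<noteq> {}" "Y \<noteq> {}"
    and "h \<le> n - k"
    and "\<And>x. x \<in> X \<Longrightarrow> h \<le> card (nbr x \<inter> X)" "\<And>y. y \<in> Y \<Longrightarrow> h \<le> card (nbr y \<inter> Y)"
  shows "cut_value (n - k) (card F) h \<le> card (cross n k X Y)"
  using assms
proof (induction "card F" arbitrary: F p X Y h)
  case (0 F)
  then show ?case by (simp add: cut_value_def)
next
  case (Suc d F)
  note p = \<open>p \<in> P\<close> and F = Suc(4) and V = Suc(5) and disj = Suc(6) and h = Suc(9) and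
    deg = Suc(10,11)
  have finF: "finite F" using F finite_subset by blast
  have fin: "finite X" "finite Y" using V finite_fiber by (metis finite_Un)+
  have XP: "X \<subseteq> P" "Y \<subseteq> P" using V fiber_subset by blast+
  have large: "h + 1 \<le> card Z" if "x \<in> Z" "finite Z" "Z \<subseteq> P" "h \<le> card (nbr x \<inter> Z)" for x Z
  proof -
    have "nbr x \<inter> Z \<subseteq> Z - {x}" using nbr_irrefl that by blast
    then have "card (nbr x \<inter> Z) \<le> card (Z - {x})" using that by (intro card_mono) auto
    moreover have "card Z > 0" using that by (auto simp: card_gt_0_iff)
    ultimately show ?thesis using that by simp
  qed
  have size: "h + 1 \<le> card X" "h + 1 \<le> card Y"
  proof -
    obtain x y where "x \<in> X" "y \<in> Y" using \<open>X \<noteq> {}\<close> \<open>Y \<noteq> {}\<close> by blast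
    then show "h + 1 \<le> card X" "h + 1 \<le> card Y"
      using large[OF _ fin(1) XP(1)] large[OF _ fin(2) XP(2)] deg by simp_all
  qed
  show ?case
  proof (cases "h = 0 \<or> d = 0")
    \<comment> \<open>Here the cut value is \<open>n - k + card F\<close>, the connectivity bound:
      for \<open>card F = 1\<close> both branches of \<open>cut_value\<close> that can occur give
      \<open>n - k + 1\<close>.\<close>
    case True
    have "n - k + card F \<le> card (cross n k X Y)"
      using card_cross_connectivity[OF p F V disj] Suc(7,8) by blast
    moreover have "cut_value (n - k) (card F) h = n - k + card F"
      using True \<open>Suc d = card F\<close>[symmetric] by (cases "h = 0") (auto simp: cut_value_def)
    ultimately show ?thesis by simp
  next
    case False
    show ?thesis
    proof (rule narrow_cases[OF p F V])
      assume "\<And>q. q \<in> F \<Longrightarrow> \<exists>a. X \<subseteq> {x. x ! q = a}"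
      then have "card X \<le> n - k + 1" using card_narrow_le[OF F, of X p] V by blast
      then show ?thesis
        using cut_value_le_clique[OF size(1)] card_cross_ge_mult[OF F V] le_trans by blast
    next
      assume "\<And>q. q \<in> F \<Longrightarrow> \<exists>a. Y \<subseteq> {x. x ! q = a}"
      then have "card Y \<le> n - k + 1" using card_narrow_le[OF F, of Y p] V by blast
      moreover have "Y \<union> X = fiber n k F p" using V by blast
      ultimately show ?thesis
        using cut_value_le_clique[OF size(2)] card_cross_ge_mult[OF F, of Y X p]
          card_cross_commute[OF XP] le_trans by metis
    next
      fix q assume q: "q \<in> F"
        and wide: "\<nexists>a. X \<subseteq> {x. x ! q = a}" "\<nexists>a. Y \<subseteq> {x. x ! q = a}"
      have d: "card (F - {q}) = d" using q Suc(2) finF by simp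
      have qk: "q \<in> {1..<k}" using q F by blast
      \<comment> \<open>The swap with \<open>q\<close> is the only neighbour that can be
        lost.\<close>
      have deg_slice: "h - 1 \<le> card (nbr x \<inter> {x \<in> Z. x ! q = a})"
        if Z: "x \<in> {x \<in> Z. x ! q = a}" "Z \<subseteq> P" "finite Z" "h \<le> card (nbr x \<inter> Z)" for x Z a
      proof -
        have "nbr x \<inter> Z \<subseteq> insert (x[0 := x ! q, q := x ! 0]) (nbr x \<inter> {x \<in> Z. x ! q = a})"
          using nbr_leaving_slice[OF _ _ qk] Z by blast
        then have "card (nbr x \<inter> Z) \<le>
            card (insert (x[0 := x ! q, q := x ! 0]) (nbr x \<inter> {x \<in> Z. x ! q = a}))"
          using Z(3) by (intro card_mono) auto
        also have "\<dots> \<le> Suc (card (nbr x \<inter> {x \<in> Z. x ! q = a}))"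
          by (rule card_insert_le_m1[THEN order_trans]) auto
        finally show ?thesis using Z(4) by simp
      qed
      have slice: "cut_value (n - k) d (h - 1) \<le>
          card (cross n k {x \<in> X. x ! q = a} {x \<in> Y. x ! q = a})"
        if ne: "{x \<in> X. x ! q = a} \<noteq> {}" "{x \<in> Y. x ! q = a} \<noteq> {}" for a
      proof -
        obtain x where x: "x \<in> P"
          "{x \<in> X. x ! q = a} \<union> {x \<in> Y. x ! q = a} = fiber n k (F - {q}) x"
          using slice_partition[OF F q V ne(1)] by blast
        have "h - 1 \<le> card (nbr x \<inter> {x \<in> X. x ! q = a})" if "x \<in> {x \<in> X. x ! q = a}" for x
          using deg_slice[OF that XP(1) fin(1)] deg(1) that by blast
        moreover have "h - 1 \<le> card (nbr x \<inter> {x \<in> Y. x ! q = a})"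
          if "x \<in> {x \<in> Y. x ! q = a}" for x
          using deg_slice[OF that XP(2) fin(2)] deg(2) that by blast
        moreover have "F - {q} \<subseteq> {1..<k}" "h - 1 \<le> n - k"
          "{x \<in> X. x ! q = a} \<inter> {x \<in> Y. x ! q = a} = {}"
          using F h disj by auto
        ultimately show ?thesis
          using Suc(1)[OF d[symmetric] x(1) _ x(2) _ ne, of "h - 1"] d by simp
      qed
      have d': "card F = Suc d" using Suc(2) by simp
      \<comment> \<open>A second position in \<open>F\<close> makes the weight in
        \<open>slice_cases\<close> equal to \<open>n - k + 1\<close>.\<close>
      have "F \<noteq> {q}" using d' False by auto
      have h1: "2 \<le> card F" "1 \<le> h" using d' False by auto
      have mono: "(n - k + 1) * (n - k + card F - 1) \<le> (n - k + 1) * (n - k + card F)"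
        by (intro mult_le_mono) auto
      have slices: "2 * cut_value (n - k) d (h - 1) \<le> card (cross n k X Y) \<or>
          (n - k + 1) * (n - k + card F - 1) + cut_value (n - k) d (h - 1)
            \<le> card (cross n k X Y) \<or>
          (n - k + 1) * (n - k + card F) \<le> card (cross n k X Y)"
        using slice_cases[OF p F q V disj wide, of "cut_value (n - k) d (h - 1)"] slice \<open>F \<noteq> {q}\<close>
        by simp
      have double: "cut_value (n - k) (card F) h \<le> 2 * cut_value (n - k) d (h - 1)"
        using cut_value_le_double[OF h1 h] d' by simp
      from slices show ?thesis
        using mono double cut_value_le_slices[OF h1 h] by (meson add_leD1 le_trans)
    qed
  qed
qed

section \<open>From edge cuts to vertex partitions\<close>

lemma fiber_all: "fiber n k {1..<k} p = P"
  by (simp add: fiber_def)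

lemma verts_star_graph: "verts (star_graph n k) = P"
  by (simp add: star_graph_def)

lemma edge_star_graph_iff:
  assumes "x \<in> P"
  shows "{x, y} \<in> edges (star_graph n k) \<longleftrightarrow> y \<in> nbr x"
proof
  assume "{x, y} \<in> edges (star_graph n k)"
  then obtain p q where "{x, y} = {p, q}" "p \<in> P" "q \<in> nbr p"
    by (auto simp: star_graph_def)
  then show "y \<in> nbr x" using nbr_sym by (auto simp: doubleton_eq_iff)
qed (use assms in \<open>auto simp: star_graph_def\<close>)

lemma degree_delete_edges:
  assumes "x \<in> P"
  shows "degree (delete_edges (star_graph n k) B) x = card {y \<in> nbr x. {x, y} \<notin> B}"
proof -
  have "\<exists>y. e = {x, y}" if "e \<in> edges (star_graph n k)" "x \<in> e" for e
    using that by (auto simp: star_graph_def)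
  then have "{e \<in> edges (star_graph n k) - B. x \<in> e} = (\<lambda>y. {x, y}) ` {y \<in> nbr x. {x, y} \<notin> B}"
    using edge_star_graph_iff[OF assms] by blast
  moreover have "inj_on (\<lambda>y. {x, y}) {y \<in> nbr x. {x, y} \<notin> B}"
    by (auto simp: inj_on_def doubleton_eq_iff)
  ultimately show ?thesis by (simp add: degree_def delete_edges_def card_image)
qed

lemma inj_on_edge_of_pair:
  assumes "X \<inter> Y = {}"
  shows "inj_on (\<lambda>(x, y). {x, y}) (cross n k X Y)"
  using assms by (auto simp: inj_on_def cross_def doubleton_eq_iff)

text \<open>Let \<open>X\<close> be the component of a vertex \<open>u\<close> after deletion and
  \<open>Y\<close> the rest. Surviving edges stay on one side, so both sides keep minimum degree
  \<open>h\<close>, and every crossing edge belongs to \<open>B\<close>.\<close>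

lemma h_edge_cut_lower:
  assumes cut: "h_edge_cut (star_graph n k) h B" and h: "h \<le> n - k"
  shows "cut_value (n - k) (k - 1) h \<le> card B"
proof -
  let ?G = "delete_edges (star_graph n k) B"
  define R where "R = {(x, y). {x, y} \<in> edges ?G}"
  have B: "B \<subseteq> edges (star_graph n k)" and deg: "h \<le> min_degree ?G"
    and disc: "\<not> connected_graph ?G" using cut by (auto simp: h_edge_cut_def)
  have verts: "verts ?G = P" by (simp add: delete_edges_def verts_star_graph)
  \<comment> \<open>\<open>connected_graph\<close> also fails on an empty vertex set, which has to
    be excluded before two separated vertices can be obtained.\<close>
  have "[1..<k + 1] \<in> P" using k_less by (auto simp: k_permutations_def)
  then have "P \<noteq> {}" by blast
  then have "\<not> (\<forall>u\<in>P. \<forall>v\<in>P. (u, v) \<in> R\<^sup>*)"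
    using disc unfolding connected_graph_def verts R_def[symmetric] by simp
  then obtain u v where u: "u \<in> P" and v: "v \<in> P" "(u, v) \<notin> R\<^sup>*" by blast
  have step: "(x, y) \<in> R \<longleftrightarrow> y \<in> nbr x \<and> {x, y} \<notin> B" if "x \<in> P" for x y
    using edge_star_graph_iff[OF that] by (auto simp: R_def delete_edges_def)
  define X where "X = {x \<in> P. (u, x) \<in> R\<^sup>*}"
  define Y where "Y = P - X"
  have XY: "X \<union> Y = P" "X \<inter> Y = {}" by (auto simp: X_def Y_def)
  have closed_X: "y \<in> X" if "x \<in> X" "y \<in> nbr x" "{x, y} \<notin> B" for x y
  proof -
    have "x \<in> P" "(u, x) \<in> R\<^sup>*" using that by (auto simp: X_def)
    moreover have "(x, y) \<in> R" using step[OF \<open>x \<in> P\<close>] that by simp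
    moreover have "y \<in> P" using nbr_subset[OF \<open>x \<in> P\<close>] that by blast
    ultimately show ?thesis by (simp add: X_def)
  qed
  have closed_Y: "y \<in> Y" if "x \<in> Y" "y \<in> nbr x" "{x, y} \<notin> B" for x y
  proof -
    have x: "x \<in> P" "x \<notin> X" using that by (auto simp: Y_def)
    have "y \<in> P" "x \<in> nbr y" using nbr_subset[OF x(1)] nbr_sym[OF x(1)] that by blast+
    moreover have "{y, x} \<notin> B" using that(3) by (simp add: insert_commute)
    ultimately show ?thesis using closed_X[of y x] x by (auto simp: Y_def)
  qed
  have deg_h: "h \<le> card {y \<in> nbr x. {x, y} \<notin> B}" if "x \<in> P" for x
  proof -
    have "min_degree ?G \<le> degree ?G x"
      unfolding min_degree_def verts using that finite_k_permutations by (intro Min_le) auto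
    then show ?thesis using deg degree_delete_edges[OF that, of B] by simp
  qed
  have deg_X: "h \<le> card (nbr x \<inter> X)" if "x \<in> X" for x
  proof -
    have xP: "x \<in> P" using that XY by blast
    have "card {y \<in> nbr x. {x, y} \<notin> B} \<le> card (nbr x \<inter> X)"
    proof (rule card_mono)
      show "{y \<in> nbr x. {x, y} \<notin> B} \<subseteq> nbr x \<inter> X" using closed_X[OF that] by blast
    qed (simp add: finite_nbr[OF xP])
    then show ?thesis using deg_h[OF xP] by simp
  qed
  have deg_Y: "h \<le> card (nbr x \<inter> Y)" if "x \<in> Y" for x
  proof -
    have xP: "x \<in> P" using that XY by blast
    have "card {y \<in> nbr x. {x, y} \<notin> B} \<le> card (nbr x \<inter> Y)"
    proof (rule card_mono)
      show "{y \<in> nbr x. {x, y} \<notin> B} \<subseteq> nbr x \<inter> Y" using closed_Y[OF that] by blast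
    qed (simp add: finite_nbr[OF xP])
    then show ?thesis using deg_h[OF xP] by simp
  qed
  have "u \<in> X" "v \<in> Y" using u v by (auto simp: X_def Y_def)
  then have ne: "X \<noteq> {}" "Y \<noteq> {}" by blast+
  \<comment> \<open>The whole graph is the fiber in which all \<open>k - 1\<close> positions other
    than 0 vary.\<close>
  have "X \<union> Y = fiber n k {1..<k} u" unfolding fiber_all by (rule XY)
  from card_cross_ge_cut_value[OF u subset_refl this XY(2) ne h deg_X deg_Y]
  have "cut_value (n - k) (k - 1) h \<le> card (cross n k X Y)" by simp
  also have "\<dots> \<le> card B"
  proof (rule card_inj_on_le[OF inj_on_edge_of_pair[OF XY(2)]])
    show "(\<lambda>(x, y). {x, y}) ` cross n k X Y \<subseteq> B"
    proof (intro image_subsetI)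
      fix e assume "e \<in> cross n k X Y"
      then obtain x y where e: "e = (x, y)" "x \<in> X" "y \<in> Y" "y \<in> nbr x"
        by (auto simp: cross_def)
      then have "{x, y} \<in> B" using closed_X[of x y] XY(2) by blast
      then show "(case e of (x, y) \<Rightarrow> {x, y}) \<in> B" using e by simp
    qed
    have "B \<subseteq> Pow P"
      using B finite_simple_graph_star_graph[OF k_pos, of n] verts_star_graph
      unfolding finite_simple_graph_def by blast
    then show "finite B" by (rule finite_subset) (simp add: finite_k_permutations)
  qed
  finally show ?thesis .
qed

section \<open>Cuts attaining the bound\<close>

text \<open>Deleting all edges that leave \<open>X\<close> separates it from its complement, while
  each vertex keeps the neighbours on its own side.\<close>

lemma h_edge_cut_of_set:
  assumes X: "X \<subseteq> P" "X \<noteq> {}" "P - X \<noteq> {}"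
    and deg_X: "\<And>x. x \<in> X \<Longrightarrow> h \<le> card (nbr x \<inter> X)"
    and deg_Y: "\<And>y. y \<in> P - X \<Longrightarrow> h \<le> card (nbr y - X)"
  obtains B where "h_edge_cut (star_graph n k) h B" "card B = card (cross n k X (P - X))"
proof
  define B where "B = (\<lambda>(x, y). {x, y}) ` cross n k X (P - X)"
  let ?B = "(\<lambda>(x, y). {x, y}) ` cross n k X (P - X)"
  let ?G = "delete_edges (star_graph n k) B"
  have mem_B: "{x, y} \<in> B \<longleftrightarrow> y \<notin> X" if "x \<in> X" "y \<in> nbr x" for x y
  proof -
    have "y \<in> P" using that X nbr_subset by blast
    then show ?thesis using that by (fastforce simp: B_def cross_def doubleton_eq_iff)
  qed
  have mem_B': "{x, y} \<notin> B" if "x \<in> P - X" "y \<in> nbr x - X" for x y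
    using that by (auto simp: B_def cross_def doubleton_eq_iff)
  have verts: "verts ?G = P" by (simp add: delete_edges_def verts_star_graph)
  have "B \<subseteq> edges (star_graph n k)"
    using X edge_star_graph_iff by (auto simp: B_def cross_def)
  moreover have "\<not> connected_graph ?G"
  proof
    assume conn: "connected_graph ?G"
    obtain x y where x: "x \<in> X" and y: "y \<in> P - X" using X by blast
    have "(x, y) \<in> {(x, y). {x, y} \<in> edges ?G}\<^sup>*"
      using conn x y X unfolding connected_graph_def verts by blast
    then have "y \<in> X"
    proof (induction rule: rtrancl_induct)
      case (step y z)
      have "y \<in> P" using step X by blast
      have "{y, z} \<in> edges (star_graph n k)" "{y, z} \<notin> B"
        using step by (auto simp: delete_edges_def)
      then show ?case using mem_B[OF step.IH] edge_star_graph_iff[OF \<open>y \<in> P\<close>] by blast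
    qed (rule x)
    then show False using y by blast
  qed
  moreover have "h \<le> degree ?G x" if x: "x \<in> P" for x
  proof (cases "x \<in> X")
    case True
    have "nbr x \<inter> X \<subseteq> {y \<in> nbr x. {x, y} \<notin> B}" using mem_B[OF True] by blast
    then have "card (nbr x \<inter> X) \<le> card {y \<in> nbr x. {x, y} \<notin> B}"
      using finite_nbr[OF x] by (intro card_mono) auto
    then show ?thesis using deg_X[OF True] degree_delete_edges[OF x] by simp
  next
    case False
    then have "nbr x - X \<subseteq> {y \<in> nbr x. {x, y} \<notin> B}" using mem_B' x by blast
    then have "card (nbr x - X) \<le> card {y \<in> nbr x. {x, y} \<notin> B}"
      using finite_nbr[OF x] by (intro card_mono) auto
    then show ?thesis using deg_Y[of x] x False degree_delete_edges[OF x] by simp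
  qed
  then have "h \<le> min_degree ?G"
    unfolding min_degree_def verts using finite_k_permutations X by (subst Min_ge_iff) auto
  ultimately show "h_edge_cut (star_graph n k) h ?B"
    unfolding h_edge_cut_def B_def by blast
  show "card ?B = card (cross n k X (P - X))"
    by (rule card_image[OF inj_on_edge_of_pair]) blast
qed

text \<open>With \<open>F = {}\<close> two members differ only in the first symbol, so one arises
  from the other by a replacement.\<close>

lemma clique_adjacent:
  assumes x: "x \<in> fiber n k {} p" and y: "y \<in> fiber n k {} p" and "x \<noteq> y"
  shows "y \<in> nbr x"
proof -
  have len: "length x = k" "length y = k" "distinct y" "set y \<subseteq> {1..n}"
    using x y by (auto simp: fiber_def k_permutations_def)
  have agree: "x ! i = y ! i" if "0 < i" "i < k" for i
    using x y that by (auto simp: fiber_def)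
  have upd: "y = x[0 := y ! 0]"
  proof (rule nth_equalityI)
    fix i assume "i < length y"
    then show "y ! i = x[0 := y ! 0] ! i" using agree[of i] len by (cases "i = 0") auto
  qed (use len in simp)
  have "y ! 0 \<notin> set x"
  proof
    assume "y ! 0 \<in> set x"
    then obtain i where i: "i < k" "x ! i = y ! 0" using len by (metis in_set_conv_nth)
    show False
    proof (cases "i = 0")
      case True
      then show False using i upd \<open>x \<noteq> y\<close> by (metis list_update_id)
    next
      case False
      then have "y ! i = y ! 0" using agree[of i] i by simp
      then show False using False i len k_pos nth_eq_iff_index_eq[of y i 0] by simp
    qed
  qed
  moreover have "y ! 0 \<in> {1..n}" using len k_pos nth_mem[of 0 y] by (metis One_nat_def Suc_le_lessD subsetD)
  ultimately show ?thesis using upd unfolding star_neighbours_def by blast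
qed

lemma card_clique:
  assumes "p \<in> P"
  shows "card (fiber n k {} p) = n - k + 1"
proof (rule antisym)
  show "card (fiber n k {} p) \<le> n - k + 1" by (rule card_narrow_le[of "{}" _ p]) auto
  have len: "length p = k" using assms by (simp add: k_permutations_def)
  let ?C = "{1..n} - (!) p ` ({..<k} - {0})"
  have "(\<lambda>a. p[0 := a]) ` ?C \<subseteq> fiber n k {} p"
    using update_fiber[OF fiber_self[OF assms], of 0 "{}"] by blast
  moreover have "inj_on (\<lambda>a. p[0 := a]) ?C"
    by (rule inj_on_inverseI[where g = "\<lambda>y. y ! 0"]) (use len k_pos in simp)
  ultimately have "card ?C \<le> card (fiber n k {} p)"
    by (intro card_inj_on_le[OF _ _ finite_fiber])
  then show "n - k + 1 \<le> card (fiber n k {} p)"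
    using card_symbols_except[OF assms, of 0] k_pos by simp
qed

text \<open>Cut off \<open>t + 1\<close> vertices of a clique; each has \<open>t\<close> neighbours
  inside the set and \<open>n - 1 - t\<close> outside. The choices of \<open>t\<close> are the two
  ends of the range in \<open>cut_value_le_clique\<close>.\<close>

lemma clique_cut:
  assumes "2 \<le> k" and h: "h \<le> n - k" and t: "t = h \<and> 2 * h + 2 \<le> n \<or> t = n - k"
  obtains B where "h_edge_cut (star_graph n k) h B" "card B = (t + 1) * (n - 1 - t)"
proof -
  define p where "p = [1..<k + 1]"
  have p: "p \<in> P" using k_less by (auto simp: p_def k_permutations_def)
  let ?K = "fiber n k {} p"
  have "t + 1 \<le> card ?K" using card_clique[OF p] t h by auto
  then obtain X where X: "X \<subseteq> ?K" "card X = t + 1" "finite X"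
    by (rule obtain_subset_with_card_n)
  have XP: "X \<subseteq> P" using X fiber_subset by blast
  have nbr_X: "nbr x \<inter> X = X - {x}" if "x \<in> X" for x
    using clique_adjacent[of x p] nbr_irrefl X XP that by blast
  have card_nbr_X: "card (nbr x \<inter> X) = t" if "x \<in> X" for x
    using nbr_X[OF that] X that by simp
  have out: "card (nbr x \<inter> (P - X)) = n - 1 - t" if "x \<in> X" for x
  proof -
    have xP: "x \<in> P" using that XP by blast
    have "nbr x \<inter> (P - X) = nbr x - (nbr x \<inter> X)" using nbr_subset[OF xP] by blast
    then show ?thesis
      using card_nbr[OF xP] card_nbr_X[OF that] finite_nbr[OF xP] by (simp add: card_Diff_subset)
  qed
  have "card (cross n k X (P - X)) = (t + 1) * (n - 1 - t)"
    using card_cross_eq_sum[of X "P - X"] X out finite_k_permutations by simp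
  moreover have "X \<noteq> {}" using X by auto
  moreover have "P - X \<noteq> {}"
  proof -
    obtain x where x: "x \<in> X" using \<open>X \<noteq> {}\<close> by blast
    have "n - 1 - t > 0" using t h \<open>2 \<le> k\<close> k_less by auto
    then have "nbr x \<inter> (P - X) \<noteq> {}" using out[OF x] by auto
    then show ?thesis by blast
  qed
  moreover have "h \<le> card (nbr x \<inter> X)" if "x \<in> X" for x
    using card_nbr_X[OF that] t h by auto
  moreover have "h \<le> card (nbr y - X)" if y: "y \<in> P - X" for y
  proof (cases "t = n - k")
    \<comment> \<open>\<open>X\<close> is a whole clique. A vertex outside lies in another clique,
      disjoint from \<open>X\<close>, and keeps its \<open>n - k\<close> neighbours there.\<close>
    case True
    then have "X = ?K"
      using X card_clique[OF p] finite_fiber by (metis card_subset_eq)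
    then have "fiber n k {} y \<inter> X = {}" using y by (auto simp: fiber_def)
    then have "fiber n k {} y - {y} \<subseteq> nbr y - X"
      using clique_adjacent[of y y] fiber_self[of y "{}"] y by blast
    then have "card (fiber n k {} y - {y}) \<le> card (nbr y - X)"
      using finite_nbr y by (intro card_mono) auto
    then show ?thesis
      using card_clique[of y] fiber_self[of y "{}"] y h by simp
  next
    case False
    \<comment> \<open>Now \<open>t = h\<close>, and \<open>y\<close> keeps at least
      \<open>n - 1 - (h + 1)\<close> neighbours, which is at least \<open>h\<close> by
      \<open>2 * h + 2 \<le> n\<close>.\<close>
    have "card (nbr y) - card X \<le> card (nbr y - X)" by (rule diff_card_le_card_Diff[OF X(3)])
    then show ?thesis using card_nbr[of y] y X False t by auto
  qed
  ultimately show ?thesis using h_edge_cut_of_set[OF XP] that by metis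
qed

end

theorem theorem1p1:
  fixes n k h :: nat
  assumes "2 \<le> k" and "k \<le> n - 1" and "h \<le> n - k"
  shows "(\<exists>B. h_edge_cut (star_graph n k) h B) \<and>
    super_edge_connectivity h (star_graph n k) =
      (if h \<le> k - 2 \<and> real h \<le> real n / 2 - 1
       then (n - h - 1) * (h + 1)
       else (n - k + 1) * (k - 1))"
proof -
  interpret star_parameters n k by unfold_locales (use assms in auto)
  \<comment> \<open>Adding \<open>h \<le> n - k\<close> and \<open>h \<le> k - 2\<close> gives
    \<open>2 * h + 2 \<le> n\<close>, so the condition of the statement matches the case split of
    \<open>cut_value\<close> at \<open>d = k - 1\<close>.\<close>
  have cond: "h \<le> k - 2 \<and> real h \<le> real n / 2 - 1 \<longleftrightarrow> h < k - 1"
  proof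
    assume "h < k - 1"
    then have "2 * h + 2 \<le> n" using assms by linarith
    then show "h \<le> k - 2 \<and> real h \<le> real n / 2 - 1" using \<open>h < k - 1\<close> by auto
  qed (use assms in linarith)
  \<comment> \<open>The optimum is attained by \<open>t = h\<close> if \<open>h < k - 1\<close>, and
    by a whole clique, \<open>t = n - k\<close>, otherwise.\<close>
  obtain B where B: "h_edge_cut (star_graph n k) h B" "card B = cut_value (n - k) (k - 1) h"
  proof (cases "h < k - 1")
    case True
    then have "h = h \<and> 2 * h + 2 \<le> n \<or> h = n - k" using assms by linarith
    from clique_cut[OF assms(1,3) this] obtain B where
      B: "h_edge_cut (star_graph n k) h B" "card B = (h + 1) * (n - 1 - h)" by blast
    have "n - k + (k - 1) - h = n - 1 - h" using assms by linarith
    then have "card B = cut_value (n - k) (k - 1) h"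
      using B(2) True by (simp add: cut_value_def mult.commute)
    then show ?thesis using that[OF B(1)] by blast
  next
    case False
    have "n - k = h \<and> 2 * h + 2 \<le> n \<or> n - k = n - k" by simp
    from clique_cut[OF assms(1,3) this] obtain B where
      B: "h_edge_cut (star_graph n k) h B" "card B = (n - k + 1) * (n - 1 - (n - k))" by blast
    have "n - 1 - (n - k) = k - 1" using assms by linarith
    then have "card B = cut_value (n - k) (k - 1) h"
      using B(2) False by (simp add: cut_value_def)
    then show ?thesis using that[OF B(1)] by blast
  qed
  have "super_edge_connectivity h (star_graph n k) = cut_value (n - k) (k - 1) h"
    unfolding super_edge_connectivity_def
  proof (rule Least_equality)
    show "\<exists>B. h_edge_cut (star_graph n k) h B \<and> card B = cut_value (n - k) (k - 1) h"
      using B by blast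
  next
    fix m assume "\<exists>B. h_edge_cut (star_graph n k) h B \<and> card B = m"
    then show "cut_value (n - k) (k - 1) h \<le> m" using h_edge_cut_lower assms(3) by blast
  qed
  moreover have "n - k + (k - 1) - h = n - h - 1" using assms by linarith
  ultimately show ?thesis
    using B(1) unfolding cond cut_value_def by auto
qed

end
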